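(* Let $\gamma_1(x)=\cos x$, $\gamma_2(x)=\sin x$ and $h=0$, and let $a,b\in\mathbb R$ with $\sin(b-a)\neq0$. The trigonometric Bernstein basis functions satisfy the degree elevation formula: for all $0\le k\le n$ and all $x\in\mathbb R$, $$B_k^n(x,[a,b];\gamma)=\frac{(n+2-k)(n+1-k)}{(n+1)(n+2)}B_k^{n+2}(x,[a,b];\gamma)+\frac{2\cos(b-a)(k+1)(n+1-k)}{(n+1)(n+2)}B_{k+1}^{n+2}(x,[a,b];\gamma)+\frac{(k+1)(k+2)}{(n+1)(n+2)}B_{k+2}^{n+2}(x,[a,b];\gamma).$$
   Context: For $m\ge0$ and $0\le k\le m$, the trigonometric Bernstein basis functions (the $h=0$ case of the $h$--$\gamma$ Bernstein basis functions for $\gamma_1=\cos$, $\gamma_2=\sin$) are $$B_k^m(x,[a,b];\gamma)=\binom{m}{k}\frac{\sin^k(x-a)\,\sin^{m-k}(b-x)}{\sin^m(b-a)}.$$ Here $[a,b]$ denotes the interval determined by the endpoints $a,b$ in either order. *)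

theory Defs
  imports Complex_Main
begin

text \<open>
  The trigonometric Bernstein basis functions on the interval with endpoints \<open>a\<close> and \<open>b\<close>. No order
  is assumed between \<open>a\<close> and \<open>b\<close>, but their roles are not symmetric: exchanging them turns the
  index \<open>k\<close> into \<open>m - k\<close>. The basis consists of the functions with \<open>k \<le> m\<close>, and is meaningful
  only if \<open>sin (b - a) \<noteq> 0\<close>.
\<close>

definition trig_bernstein :: "nat \<Rightarrow> nat \<Rightarrow> real \<Rightarrow> real \<Rightarrow> real \<Rightarrow> real" where
  "trig_bernstein m k a b x =
     real (m choose k) * (sin (x - a) ^ k * sin (b - x) ^ (m - k) / sin (b - a) ^ m)"

end

theory Submission
  imports Defs
begin

text \<open>
  Each coefficient times its binomial coefficient of degree \<open>n + 2\<close> is \<open>n choose k\<close> (up to the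
  factor \<open>2 * cos (b - a)\<close>), so the right-hand side is \<open>trig_bernstein n k a b x\<close> times
  \<open>(sin v ^ 2 + 2 * cos (u + v) * sin u * sin v + sin u ^ 2) / sin (u + v) ^ 2 = 1\<close>, where
  \<open>u = x - a\<close> and \<open>v = b - x\<close>.
\<close>

text \<open>This is the law of cosines for a triangle with angles \<open>u\<close>,
  \<open>v\<close>, \<open>pi - (u + v)\<close> and circumdiameter 1; as an identity it holds for
  all real \<open>u\<close>, \<open>v\<close>.\<close>

lemma sin_add_squared:
  fixes u v :: real
  shows "sin (u + v) ^ 2 = sin v ^ 2 + 2 * cos (u + v) * sin u * sin v + sin u ^ 2"
  unfolding sin_add cos_add using sin_cos_squared_add[of u] sin_cos_squared_add[of v] by algebra

text \<open>This absorption rule raises both indices, the next one only the upper index. Two such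
  steps lead from row \<open>n\<close> to row \<open>n + 2\<close>.\<close>

lemma Suc_times_binomial_real:
  "(real k + 1) * real (Suc n choose Suc k) = (real n + 1) * real (n choose k)"
  using arg_cong[OF Suc_times_binomial[of k n], of real] by (simp add: algebra_simps)

lemma Suc_diff_times_binomial_real:
  assumes "k \<le> n"
  shows "(real n + 1 - real k) * real (Suc n choose k) = (real n + 1) * real (n choose k)"
proof -
  have "real n + 1 - real k = real (Suc n - k)"
    using assms by (simp add: of_nat_diff)
  then show ?thesis
    using arg_cong[OF binomial_absorb_comp[of "Suc n" k], of real]
    by (simp only: of_nat_mult) simp
qed

theorem proposition5p16:
  fixes a b x :: real and n k :: nat
  assumes "sin (b - a) \<noteq> 0" and "k \<le> n"
  shows "trig_bernstein n k a b x =
      (real n + 2 - real k) * (real n + 1 - real k) / ((real n + 1) * (real n + 2))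
        * trig_bernstein (n + 2) k a b x
    + 2 * cos (b - a) * (real k + 1) * (real n + 1 - real k) / ((real n + 1) * (real n + 2))
        * trig_bernstein (n + 2) (k + 1) a b x
    + (real k + 1) * (real k + 2) / ((real n + 1) * (real n + 2))
        * trig_bernstein (n + 2) (k + 2) a b x"
proof -
  define p q s c C N where "p = sin (x - a)" and "q = sin (b - x)" and "s = sin (b - a)"
    and "c = cos (b - a)" and "C = real (n choose k)" and "N = (real n + 1) * (real n + 2)"
  \<comment> \<open>The denominator already has degree \<open>n + 2\<close>, so each summand on the
    right becomes \<open>T\<close> times one term of \<open>sq\<close>.\<close>
  define T where "T = C * (p ^ k * q ^ (n - k) / s ^ (n + 2))"
  have N: "N \<noteq> 0" unfolding N_def by (simp add: add_eq_0_iff)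
  have s: "s \<noteq> 0" using assms(1) by (simp add: s_def)
  have sq: "s ^ 2 = q ^ 2 + 2 * c * p * q + p ^ 2"
    using sin_add_squared[of "x - a" "b - x"] by (simp add: p_def q_def s_def c_def)
  have "(real n + 2 - real k) * (real n + 1 - real k) * real ((n + 2) choose k) = N * C"
    using Suc_diff_times_binomial_real[of k n] Suc_diff_times_binomial_real[of k "Suc n"] assms(2)
    unfolding N_def C_def by (simp add: algebra_simps) algebra
  then have c0: "(real n + 2 - real k) * (real n + 1 - real k) / N * real ((n + 2) choose k) = C"
    using N by (simp add: field_simps)
  \<comment> \<open>One step of each kind: first \<open>k\<close> is kept, then it is
    raised.\<close>
  have "(real k + 1) * (real n + 1 - real k) * real ((n + 2) choose (k + 1)) = N * C"
    using Suc_diff_times_binomial_real[of k n] Suc_times_binomial_real[of k "Suc n"] assms(2)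
    unfolding N_def C_def by (simp del: binomial_Suc_Suc add: add.commute) algebra
  then have c1: "(real k + 1) * (real n + 1 - real k) / N * real ((n + 2) choose (k + 1)) = C"
    using N by (simp add: field_simps)
  have "(real k + 1) * (real k + 2) * real ((n + 2) choose (k + 2)) = N * C"
    using Suc_times_binomial_real[of k n] Suc_times_binomial_real[of "Suc k" "Suc n"]
    unfolding N_def C_def by (simp del: binomial_Suc_Suc add: add.commute) algebra
  then have c2: "(real k + 1) * (real k + 2) / N * real ((n + 2) choose (k + 2)) = C"
    using N by (simp add: field_simps)
  \<comment> \<open>Subtraction is truncated, so splitting the exponent relies on
    \<open>k \<le> n\<close>.\<close>
  have e0: "q ^ (n + 2 - k) = q ^ (n - k) * q ^ 2"
    using assms(2) by (simp add: Suc_diff_le power2_eq_square)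
  have e1: "q ^ (n + 2 - (k + 1)) = q ^ (n - k) * q"
    using assms(2) by (simp add: Suc_diff_le mult.commute)
  have t: "trig_bernstein n k a b x = T * s ^ 2"
    using s unfolding trig_bernstein_def T_def C_def p_def q_def s_def
    by (simp add: power2_eq_square)
  \<comment> \<open>Read backwards, \<open>c0\<close> replaces the \<open>C\<close> inside
    \<open>T\<close> by coefficient times binomial, matching the left side; \<open>c1\<close> and
    \<open>c2\<close> serve likewise below.\<close>
  have t0: "(real n + 2 - real k) * (real n + 1 - real k) / N * trig_bernstein (n + 2) k a b x
      = T * q ^ 2"
    unfolding trig_bernstein_def p_def[symmetric] q_def[symmetric] s_def[symmetric] e0 T_def
      c0[symmetric] by simp
  have t1: "2 * c * (real k + 1) * (real n + 1 - real k) / N * trig_bernstein (n + 2) (k + 1) a b x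
      = T * (2 * c * p * q)"
    unfolding trig_bernstein_def p_def[symmetric] q_def[symmetric] s_def[symmetric] e1 T_def
      c1[symmetric] by simp
  have t2: "(real k + 1) * (real k + 2) / N * trig_bernstein (n + 2) (k + 2) a b x = T * p ^ 2"
    unfolding trig_bernstein_def p_def[symmetric] q_def[symmetric] s_def[symmetric] T_def
      c2[symmetric] by (simp add: power2_eq_square)
  show ?thesis
    unfolding N_def[symmetric] c_def[symmetric] t t0 t1 t2 sq by (simp add: algebra_simps)
qed

end
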